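(* Let $\mathbb K$ be an algebraically closed field of characteristic $0$. A trilinear pair over $\mathbb K$ is a finite dimensional simple close-to-Jordan pair if and only if it is isomorphic to the signed double of a nonzero finite dimensional balanced $(1,1)$-Freudenthal-Kantor triple system with non-degenerate skew form.
   Context: A trilinear pair is a pair $P=(P^-,P^+)$ of vector spaces with trilinear products $\{\,,\,,\,\}^\sigma:P^\sigma\times P^{-\sigma}\times P^\sigma\to P^\sigma$, $\sigma=\pm$. An isomorphism $P\to P'$ is a pair of linear bijections $P^\sigma\to P'^\sigma$ preserving the products. An ideal of $P$ is a pair $(I^-,I^+)$ of subspaces $I^\sigma\subseteq P^\sigma$ such that a product lies in $(I^-,I^+)$ whenever one of its three arguments does; $P$ is simple if its products are not all zero and its only ideals are $0$ and $P$. $P$ is finite dimensional if $P^-$ and $P^+$ are. For $x,z\in P^\sigma$, $y\in P^{-\sigma}$ put $D^\sigma(x,y)u=\{x,y,u\}^\sigma$ ($u\in P^\sigma$) and $K^\sigma(x,z)w=\{x,w,z\}^\sigma-\{z,w,x\}^\sigma$ ($w\in P^{-\sigma}$). $P$ is a Kantor pair if $$[D^\sigma(x,y),D^\sigma(z,w)]=D^\sigma(D^\sigma(x,y)z,w)-D^\sigma(z,D^{-\sigma}(y,x)w),$$ $$K^\sigma(x,z)D^{-\sigma}(w,u)+D^\sigma(u,w)K^\sigma(x,z)=K^\sigma(K^\sigma(x,z)w,u)$$ for $x,z,u\in P^\sigma$, $y,w\in P^{-\sigma}$, $\sigma=\pm$. A close-to-Jordan pair is a Kantor pair with $\dim K^\sigma(P^\sigma,P^\sigma)=1$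 for $\sigma=\pm$, where $K^\sigma(P^\sigma,P^\sigma)$ denotes the span of all $K^\sigma(x,z)$. A triple system is a vector space $X$ with a trilinear product $\{\,,\,,\,\}:X\times X\times X\to X$. Its signed double is the trilinear pair $(X,X)$ with $\{\,,\,,\,\}^+=\{\,,\,,\,\}$ and $\{\,,\,,\,\}^-=-\{\,,\,,\,\}$. A $(1,1)$-Freudenthal-Kantor triple system is a triple system whose signed double is a Kantor pair. It is balanced if there is a bilinear form $\langle\,,\,\rangle:X\times X\to\mathbb K$ with $\{x,z,y\}-\{y,z,x\}=\langle x,y\rangle z$ for all $x,y,z\in X$; this form is then skew-symmetric and (for $X\neq0$) uniquely determined, and is called the skew form of $X$. *)

theory Defs
  imports "HOL-Computational_Algebra.Polynomial" "HOL-Library.Function_Algebras"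
begin

text \<open>
  Vector spaces are whole types with an explicit scalar multiplication, as in the locale
  \<^locale>\<open>vector_space\<close>. The two spaces of a pair have different types, so notions quantified
  over a sign are defined for one sign, as functions of the product \<open>t\<close> of that sign (and the
  product \<open>t'\<close> of the opposite sign), and then required for both.
\<close>

record ('k, 'm, 'p) trilin_pair =
  scale_minus :: "'k \<Rightarrow> 'm \<Rightarrow> 'm"
  scale_plus :: "'k \<Rightarrow> 'p \<Rightarrow> 'p"
  prod_minus :: "'m \<Rightarrow> 'p \<Rightarrow> 'm \<Rightarrow> 'm"
  prod_plus :: "'p \<Rightarrow> 'm \<Rightarrow> 'p \<Rightarrow> 'p"

definition trilinear ::
  "('k::field \<Rightarrow> 'a::ab_group_add \<Rightarrow> 'a) \<Rightarrow> ('k \<Rightarrow> 'b::ab_group_add \<Rightarrow> 'b) \<Rightarrow>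
   ('a \<Rightarrow> 'b \<Rightarrow> 'a \<Rightarrow> 'a) \<Rightarrow> bool" where
  "trilinear s s' t \<longleftrightarrow>
     (\<forall>y z. Vector_Spaces.linear s s (\<lambda>x. t x y z)) \<and>
     (\<forall>x z. Vector_Spaces.linear s' s (\<lambda>y. t x y z)) \<and>
     (\<forall>x y. Vector_Spaces.linear s s (\<lambda>z. t x y z))"

definition trilinear_pair ::
  "('k::field, 'm::ab_group_add, 'p::ab_group_add) trilin_pair \<Rightarrow> bool" where
  "trilinear_pair P \<longleftrightarrow>
     vector_space (scale_minus P) \<and> vector_space (scale_plus P) \<and>
     trilinear (scale_minus P) (scale_plus P) (prod_minus P) \<and>
     trilinear (scale_plus P) (scale_minus P) (prod_plus P)"

definition pair_iso ::
  "('k::field, 'm::ab_group_add, 'p::ab_group_add) trilin_pair \<Rightarrow>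
   ('k, 'm2::ab_group_add, 'p2::ab_group_add) trilin_pair \<Rightarrow>
   ('m \<Rightarrow> 'm2) \<Rightarrow> ('p \<Rightarrow> 'p2) \<Rightarrow> bool" where
  "pair_iso P Q f g \<longleftrightarrow>
     Vector_Spaces.linear (scale_minus P) (scale_minus Q) f \<and> bij f \<and>
     Vector_Spaces.linear (scale_plus P) (scale_plus Q) g \<and> bij g \<and>
     (\<forall>x y z. f (prod_minus P x y z) = prod_minus Q (f x) (g y) (f z)) \<and>
     (\<forall>x y z. g (prod_plus P x y z) = prod_plus Q (g x) (f y) (g z))"

definition isomorphic_pairs ::
  "('k::field, 'm::ab_group_add, 'p::ab_group_add) trilin_pair \<Rightarrow>
   ('k, 'm2::ab_group_add, 'p2::ab_group_add) trilin_pair \<Rightarrow> bool" where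
  "isomorphic_pairs P Q \<longleftrightarrow> (\<exists>f g. pair_iso P Q f g)"

definition pair_ideal ::
  "('k::field, 'm::ab_group_add, 'p::ab_group_add) trilin_pair \<Rightarrow> 'm set \<Rightarrow> 'p set \<Rightarrow> bool" where
  "pair_ideal P I J \<longleftrightarrow>
     module.subspace (scale_minus P) I \<and> module.subspace (scale_plus P) J \<and>
     (\<forall>x y z. x \<in> I \<or> y \<in> J \<or> z \<in> I \<longrightarrow> prod_minus P x y z \<in> I) \<and>
     (\<forall>x y z. x \<in> J \<or> y \<in> I \<or> z \<in> J \<longrightarrow> prod_plus P x y z \<in> J)"

definition simple_pair ::
  "('k::field, 'm::ab_group_add, 'p::ab_group_add) trilin_pair \<Rightarrow> bool" where
  "simple_pair P \<longleftrightarrow>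
     ((\<exists>x y z. prod_minus P x y z \<noteq> 0) \<or> (\<exists>x y z. prod_plus P x y z \<noteq> 0)) \<and>
     (\<forall>I J. pair_ideal P I J \<longrightarrow> (I = {0} \<and> J = {0}) \<or> (I = UNIV \<and> J = UNIV))"

definition fin_dim :: "('k::field \<Rightarrow> 'a::ab_group_add \<Rightarrow> 'a) \<Rightarrow> bool" where
  "fin_dim s \<longleftrightarrow> (\<exists>B. finite_dimensional_vector_space s B)"

definition fin_dim_pair ::
  "('k::field, 'm::ab_group_add, 'p::ab_group_add) trilin_pair \<Rightarrow> bool" where
  "fin_dim_pair P \<longleftrightarrow> fin_dim (scale_minus P) \<and> fin_dim (scale_plus P)"

definition D_op :: "('a \<Rightarrow> 'b \<Rightarrow> 'a \<Rightarrow> 'a) \<Rightarrow> 'a \<Rightarrow> 'b \<Rightarrow> 'a \<Rightarrow> 'a" where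
  "D_op t x y = (\<lambda>u. t x y u)"

definition K_op :: "('a \<Rightarrow> 'b \<Rightarrow> 'a \<Rightarrow> 'a::ab_group_add) \<Rightarrow> 'a \<Rightarrow> 'a \<Rightarrow> 'b \<Rightarrow> 'a" where
  "K_op t x z = (\<lambda>w. t x w z - t z w x)"

text \<open>Sums and differences of operators are pointwise (theory \<^theory>\<open>HOL-Library.Function_Algebras\<close>).\<close>

definition Kantor_identities ::
  "('a \<Rightarrow> 'b \<Rightarrow> 'a \<Rightarrow> 'a::ab_group_add) \<Rightarrow> ('b \<Rightarrow> 'a \<Rightarrow> 'b \<Rightarrow> 'b::ab_group_add) \<Rightarrow> bool" where
  "Kantor_identities t t' \<longleftrightarrow>
     (\<forall>x y z w. (D_op t x y \<circ> D_op t z w) - (D_op t z w \<circ> D_op t x y) =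
        D_op t (D_op t x y z) w - D_op t z (D_op t' y x w)) \<and>
     (\<forall>x z u w. (K_op t x z \<circ> D_op t' w u) + (D_op t u w \<circ> K_op t x z) =
        K_op t (K_op t x z w) u)"

definition Kantor_pair ::
  "('k::field, 'm::ab_group_add, 'p::ab_group_add) trilin_pair \<Rightarrow> bool" where
  "Kantor_pair P \<longleftrightarrow> trilinear_pair P \<and>
     Kantor_identities (prod_minus P) (prod_plus P) \<and>
     Kantor_identities (prod_plus P) (prod_minus P)"

definition fun_scale :: "('k \<Rightarrow> 'a \<Rightarrow> 'a) \<Rightarrow> 'k \<Rightarrow> ('b \<Rightarrow> 'a) \<Rightarrow> 'b \<Rightarrow> 'a" where
  "fun_scale s c f = (\<lambda>w. s c (f w))"

definition K_space ::
  "('k::field \<Rightarrow> 'a::ab_group_add \<Rightarrow> 'a) \<Rightarrow> ('a \<Rightarrow> 'b \<Rightarrow> 'a \<Rightarrow> 'a) \<Rightarrow> ('b \<Rightarrow> 'a) set" where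
  "K_space s t = module.span (fun_scale s) {K_op t x z | x z. True}"

text \<open>
  The library's dimension is \<open>0\<close> on infinite dimensional spaces, so the value \<open>1\<close> below
  cannot arise spuriously.
\<close>

definition close_to_Jordan_pair ::
  "('k::field, 'm::ab_group_add, 'p::ab_group_add) trilin_pair \<Rightarrow> bool" where
  "close_to_Jordan_pair P \<longleftrightarrow> Kantor_pair P \<and>
     vector_space.dim (fun_scale (scale_minus P)) (K_space (scale_minus P) (prod_minus P)) = 1 \<and>
     vector_space.dim (fun_scale (scale_plus P)) (K_space (scale_plus P) (prod_plus P)) = 1"

record ('k, 'x) trip_system =
  scale_trip :: "'k \<Rightarrow> 'x \<Rightarrow> 'x"
  prod_trip :: "'x \<Rightarrow> 'x \<Rightarrow> 'x \<Rightarrow> 'x"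

definition triple_system :: "('k::field, 'x::ab_group_add) trip_system \<Rightarrow> bool" where
  "triple_system X \<longleftrightarrow> vector_space (scale_trip X) \<and>
     trilinear (scale_trip X) (scale_trip X) (prod_trip X)"

definition signed_double ::
  "('k::field, 'x::ab_group_add) trip_system \<Rightarrow> ('k, 'x, 'x) trilin_pair" where
  "signed_double X =
     \<lparr> scale_minus = scale_trip X, scale_plus = scale_trip X,
       prod_minus = (\<lambda>x y z. - prod_trip X x y z), prod_plus = prod_trip X \<rparr>"

definition FK_triple_system_1_1 :: "('k::field, 'x::ab_group_add) trip_system \<Rightarrow> bool" where
  "FK_triple_system_1_1 X \<longleftrightarrow> triple_system X \<and> Kantor_pair (signed_double X)"

definition bilinear_form ::
  "('k::field \<Rightarrow> 'x::ab_group_add \<Rightarrow> 'x) \<Rightarrow> ('x \<Rightarrow> 'x \<Rightarrow> 'k) \<Rightarrow> bool" where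
  "bilinear_form s B \<longleftrightarrow>
     (\<forall>y. Vector_Spaces.linear s (*) (\<lambda>x. B x y)) \<and> (\<forall>x. Vector_Spaces.linear s (*) (\<lambda>y. B x y))"

definition skew_form_of ::
  "('k::field, 'x::ab_group_add) trip_system \<Rightarrow> ('x \<Rightarrow> 'x \<Rightarrow> 'k) \<Rightarrow> bool" where
  "skew_form_of X B \<longleftrightarrow> bilinear_form (scale_trip X) B \<and>
     (\<forall>x y z. prod_trip X x z y - prod_trip X y z x = scale_trip X (B x y) z)"

lemma skew_form_of_unique:
  fixes X :: "('k::field, 'x::ab_group_add) trip_system" and z :: 'x
  assumes "triple_system X" and "z \<noteq> 0" and "skew_form_of X B" and "skew_form_of X C"
  shows "B = C"
proof (intro ext)
  fix x y
  interpret vector_space "scale_trip X"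
    using assms(1) by (simp add: triple_system_def)
  have "scale_trip X (B x y) z = scale_trip X (C x y) z"
    using assms(3,4) by (metis skew_form_of_def)
  then show "B x y = C x y"
    using assms(2) by simp
qed

definition balanced :: "('k::field, 'x::ab_group_add) trip_system \<Rightarrow> bool" where
  "balanced X \<longleftrightarrow> (\<exists>B. skew_form_of X B)"

definition nondegenerate :: "('x::ab_group_add \<Rightarrow> 'x \<Rightarrow> 'k::field) \<Rightarrow> bool" where
  "nondegenerate B \<longleftrightarrow>
     (\<forall>x. (\<forall>y. B x y = 0) \<longrightarrow> x = 0) \<and> (\<forall>y. (\<forall>x. B x y = 0) \<longrightarrow> y = 0)"

text \<open>By \<open>skew_form_of_unique\<close> the form quantified in the last conjunct is the skew form.\<close>

definition nonzero_fd_balanced_FK_nondeg ::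
  "('k::field, 'x::ab_group_add) trip_system \<Rightarrow> bool" where
  "nonzero_fd_balanced_FK_nondeg X \<longleftrightarrow>
     FK_triple_system_1_1 X \<and> (UNIV :: 'x set) \<noteq> {0} \<and> fin_dim (scale_trip X) \<and>
     balanced X \<and> (\<exists>B. skew_form_of X B \<and> nondegenerate B)"

end

theory Submission
  imports Defs
begin

text \<open>
  If the \<open>K\<^sup>+(x,z)\<close> span a line, then \<open>K\<^sup>+(x,z) = b(x,z) k\<close> for a bilinear form \<open>b\<close> and a
  linear map \<open>k : P\<^sup>- \<rightarrow> P\<^sup>+\<close>. By simplicity \<open>k\<close> is bijective: its range is the positive part of
  an ideal, and its kernel together with \<open>0\<close> is an ideal. The Kantor identities yield
  \<open>k K\<^sup>-(w,v) k = - K\<^sup>+(k w, k v)\<close> in characteristic other than \<open>2\<close>, whence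
  \<open>k {w, k u, v}\<^sup>- = - {k w, u, k v}\<^sup>+\<close>. So \<open>(k, id)\<close> identifies \<open>P\<close> with the signed double of
  \<open>P\<^sup>+\<close> with product \<open>{x, k\<^sup>-\<^sup>1 y, z}\<^sup>+\<close>, and the radical of \<open>b\<close> gives an ideal, hence vanishes.
  Conversely, if \<open>K\<^sup>\<sigma>(x,z)\<close> is a non-degenerate form times a bijection, then any nonzero element
  of an ideal generates everything through \<open>K\<^sup>\<sigma>\<close>.
\<close>

section \<open>Elementwise Kantor identities and their transfer\<close>

lemma Kantor_identities_iff:
  "Kantor_identities t t' \<longleftrightarrow>
     (\<forall>x y z w v. t x y (t z w v) - t z w (t x y v) = t (t x y z) w v - t z (t' y x w) v) \<and>
     (\<forall>x z u w v. t x (t' w u v) z - t z (t' w u v) x + t u w (t x v z - t z v x) =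
        t (t x w z - t z w x) v u - t u v (t x w z - t z w x))"
  by (simp add: Kantor_identities_def D_op_def K_op_def fun_eq_iff)

text \<open>Applying \<open>g\<close> turns each identity for \<open>t\<close> into an instance of
  the one for \<open>u\<close>, and \<open>g\<close> can then be cancelled. This carries the
  identities from the pair to the double and back.\<close>

lemma Kantor_identities_inj:
  assumes "Kantor_identities u u'"
    and "inj g" "\<And>x y. g (x - y) = g x - g y" "\<And>x y. g (x + y) = g x + g y"
    and "\<And>x y z. g (t x y z) = u (g x) (f y) (g z)"
    and "\<And>x y z. f (t' x y z) = u' (f x) (g y) (f z)"
  shows "Kantor_identities t t'"
  unfolding Kantor_identities_iff
proof (intro conjI allI)
  fix x y z w v
  have "g (t x y (t z w v) - t z w (t x y v)) = g (t (t x y z) w v - t z (t' y x w) v)"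
    using assms(1) unfolding Kantor_identities_iff by (simp add: assms(3-))
  then show "t x y (t z w v) - t z w (t x y v) = t (t x y z) w v - t z (t' y x w) v"
    using \<open>inj g\<close> by (simp only: inj_eq)
next
  fix x z u w v
  have "g (t x (t' w u v) z - t z (t' w u v) x + t u w (t x v z - t z v x)) =
        g (t (t x w z - t z w x) v u - t u v (t x w z - t z w x))"
    using assms(1) unfolding Kantor_identities_iff by (simp add: assms(3-))
  then show "t x (t' w u v) z - t z (t' w u v) x + t u w (t x v z - t z v x) =
        t (t x w z - t z w x) v u - t u v (t x w z - t z w x)"
    using \<open>inj g\<close> by (simp only: inj_eq)
qed

section \<open>Identities in a Kantor pair\<close>

locale kantor =
  fixes s :: "'k::field \<Rightarrow> 'a::ab_group_add \<Rightarrow> 'a"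
    and s' :: "'k \<Rightarrow> 'b::ab_group_add \<Rightarrow> 'b"
    and t :: "'a \<Rightarrow> 'b \<Rightarrow> 'a \<Rightarrow> 'a"
    and t' :: "'b \<Rightarrow> 'a \<Rightarrow> 'b \<Rightarrow> 'b"
  assumes vs: "vector_space s" and vs': "vector_space s'"
    and tril: "trilinear s s' t" and tril': "trilinear s' s t'"
    and Kantor: "Kantor_identities t t'" and Kantor': "Kantor_identities t' t"
begin

text \<open>The axioms are symmetric in the two signs; through this instance every fact about
  \<open>t\<close> is also available for \<open>t'\<close>.\<close>

lemma flip: "kantor s' s t' t"
  using vs vs' tril tril' Kantor Kantor' by (intro kantor.intro)

lemma t_add:
  "t (x + x') y z = t x y z + t x' y z"
  "t x (y + y') z = t x y z + t x y' z"
  "t x y (z + z') = t x y z + t x y z'"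
  and t_scale:
  "t (s c x) y z = s c (t x y z)"
  "t x (s' c y) z = s c (t x y z)"
  "t x y (s c z) = s c (t x y z)"
  using tril by (simp_all add: trilinear_def Vector_Spaces.linear_iff)

lemma t_diff:
  "t (x - x') y z = t x y z - t x' y z"
  "t x (y - y') z = t x y z - t x y' z"
  "t x y (z - z') = t x y z - t x y z'"
  using t_add(1)[of "x - x'" x'] t_add(2)[of x "y - y'" y'] t_add(3)[of x y "z - z'" z']
  by (simp_all add: eq_diff_eq)

lemma t_zero: "t 0 y z = 0" "t x 0 z = 0" "t x y 0 = 0"
  using t_diff(1)[of 0 0] t_diff(2)[of x 0 0] t_diff(3)[of x y 0 0] by simp_all

abbreviation "K \<equiv> K_op t"
abbreviation "K' \<equiv> K_op t'"

lemma KP1: "t x y (t z w u) = t (t x y z) w u - t z (t' y x w) u + t z w (t x y u)"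
  using Kantor unfolding Kantor_identities_iff by (metis diff_eq_eq)

lemma KP2: "K x z (t' w u v) + t u w (K x z v) = K (K x z w) u v"
  using Kantor unfolding Kantor_identities_iff K_op_def by blast

lemma K_bilin:
  "K (x + x') z w = K x z w + K x' z w" "K x (z + z') w = K x z w + K x z' w"
  "K (s c x) z w = s c (K x z w)" "K x (s c z) w = s c (K x z w)"
  "K x z (w + w') = K x z w + K x z w'" "K x z (w - w') = K x z w - K x z w'"
  "K x z (s' c w) = s c (K x z w)"
  using module.scale_right_diff_distrib[OF vs[folded module_iff_vector_space]]
  by (simp_all add: K_op_def t_add t_scale t_diff algebra_simps)

lemma K_swap: "K z x w = - K x z w"
  by (simp add: K_op_def)

text \<open>Both terms of \<open>K'\<close> are expanded by \<open>KP2\<close>; the products with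
  \<open>u\<close> in the first slot cancel.\<close>

lemma K_K': "K x z (K' w v u) = t (K x z w) v u - t (K x z v) w u"
proof -
  have "K x z (K' w v u) = K x z (t' w u v) - K x z (t' v u w)"
    by (simp add: K_op_def[of t'] K_bilin)
  also have "\<dots> = (K (K x z w) u v - t u w (K x z v)) - (K (K x z v) u w - t u v (K x z w))"
    using KP2[of x z w u v] KP2[of x z v u w] by (metis eq_diff_eq)
  also have "\<dots> = t (K x z w) v u - t (K x z v) w u"
    by (simp add: K_op_def[of t "K x z w"] K_op_def[of t "K x z v"])
  finally show ?thesis .
qed

text \<open>The opposite-sign form of \<open>K_K'\<close> gives one expression for the left side;
  \<open>KP1\<close>, solved for products whose middle factor is \<open>t x w z\<close>, turns it
  into the one stated.\<close>

lemma K'_K: "K' w v (K x z u) = t' v (K x z w) u - t' w (K x z v) u"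
proof -
  interpret f: kantor s' s t' t by (rule flip)
  have *: "t' v (t x w z) u = t' (t' w x v) z u + t' v z (t' w x u) - t' w x (t' v z u)" for v w x z
    using f.KP1[of w x v z u] by (simp add: algebra_simps)
  show ?thesis
    unfolding f.K_K' by (simp add: K_op_def f.t_diff * algebra_simps)
qed

text \<open>By \<open>KP1\<close> the left side equals that of \<open>KP2\<close>. Its later use is
  to find how the form \<open>b\<close> behaves under the operators \<open>D\<close>.\<close>

lemma K_derivation: "K (t u w x) z v + K x (t u w z) v = K (K x z w) u v"
proof -
  have "K x z (t' w u v) + t u w (K x z v) = K (t u w x) z v + K x (t u w z) v"
    by (simp add: K_op_def t_diff KP1[of u w x v z] KP1[of u w z v x] algebra_simps)
  then show ?thesis using KP2 by simp
qed

text \<open>One operator is computed both by \<open>K'_K\<close> and by \<open>K_K'\<close>. In the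
  sum of the two results the terms pair off into instances of \<open>KP2\<close>. The factor 2 is
  divided out in \<open>k_K'_k\<close>.\<close>

lemma two_K_K'_K: "K x z (K' w v (K x z u)) + K x z (K' w v (K x z u)) =
    - (K (K x z w) (K x z v) u + K (K x z w) (K x z v) u)"
proof -
  let ?k = "K x z"
  have eq1: "?k (K' w v (?k u)) = ?k (t' v (?k w) u) - ?k (t' w (?k v) u)"
    by (simp add: K'_K K_bilin)
  have eq2: "?k (K' w v (?k u)) = t (?k w) v (?k u) - t (?k v) w (?k u)"
    by (rule K_K')
  have eq3: "?k (t' v (?k w) u) + t (?k w) v (?k u) = - K (?k w) (?k v) u"
    by (metis KP2 K_swap)
  have eq4: "?k (t' w (?k v) u) + t (?k v) w (?k u) = K (?k w) (?k v) u"
    by (rule KP2)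
  have "?k (K' w v (?k u)) + ?k (K' w v (?k u)) =
      (?k (t' v (?k w) u) - ?k (t' w (?k v) u)) + (t (?k w) v (?k u) - t (?k v) w (?k u))"
    by (rule arg_cong2[where f = "(+)", OF eq1 eq2])
  also have "\<dots> = (?k (t' v (?k w) u) + t (?k w) v (?k u)) - (?k (t' w (?k v) u) + t (?k v) w (?k u))"
    by (simp add: algebra_simps)
  finally show ?thesis unfolding eq3 eq4 by simp
qed

end

section \<open>Simple pairs in which all operators \<open>K\<close> are multiples of one map\<close>

locale simple_kantor = kantor s s' t t'
  for s :: "'k::field_char_0 \<Rightarrow> 'a::ab_group_add \<Rightarrow> 'a"
    and s' :: "'k \<Rightarrow> 'b::ab_group_add \<Rightarrow> 'b" and t t' +
  fixes b :: "'a \<Rightarrow> 'a \<Rightarrow> 'k" and k :: "'b \<Rightarrow> 'a" and x\<^sub>0 z\<^sub>0 :: 'a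
  assumes simple: "simple_pair \<lparr>scale_minus = s', scale_plus = s, prod_minus = t', prod_plus = t\<rparr>"
    and K_eq: "K_op t x z w = s (b x z) (k w)"
    and k_eq: "k = K_op t x\<^sub>0 z\<^sub>0"
    and k_nonzero: "\<exists>w. k w \<noteq> 0"
begin

sublocale V: vector_space s by (rule vs)
sublocale V': vector_space s' by (rule vs')

lemma idealD:
  assumes "V'.subspace I" "V.subspace J"
    and "\<And>x y z. x \<in> I \<Longrightarrow> t' x y z \<in> I" "\<And>x y z. y \<in> J \<Longrightarrow> t' x y z \<in> I"
    and "\<And>x y z. z \<in> I \<Longrightarrow> t' x y z \<in> I"
    and "\<And>x y z. x \<in> J \<Longrightarrow> t x y z \<in> J" "\<And>x y z. y \<in> I \<Longrightarrow> t x y z \<in> J"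
    and "\<And>x y z. z \<in> J \<Longrightarrow> t x y z \<in> J"
  shows "(I = {0} \<and> J = {0}) \<or> (I = UNIV \<and> J = UNIV)"
  using simple assms unfolding simple_pair_def pair_ideal_def by simp

lemma k_linear: "k (x + y) = k x + k y" "k (x - y) = k x - k y" "k (s' c x) = s c (k x)"
  by (simp_all add: k_eq K_bilin)

lemma k_0: "k 0 = 0"
  using k_linear(2)[of 0 0] by simp

text \<open>This is \<open>KP2\<close> for \<open>k\<close>. As the right side is a multiple of
  \<open>k v\<close>, both the range and the kernel of \<open>k\<close> are stable under products in
  the last slot.\<close>

lemma k_D: "k (t' w u v) + t u w (k v) = s (b (k w) u) (k v)"
  using KP2[of x\<^sub>0 z\<^sub>0 w u v] K_eq[of "k w" u v] by (simp add: k_eq)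

lemma t_swap: "t x y z = t z y x + s (b x z) (k y)"
  using K_eq[of x z y] by (simp add: K_op_def algebra_simps)

lemma b_unique: "b x z = c" if "\<And>w. K x z w = s c (k w)"
  using that k_nonzero K_eq V.scale_right_imp_eq by metis

lemma b_bilin:
  "b (x + x') z = b x z + b x' z" "b x (z + z') = b x z + b x z'"
  "b (s c x) z = c * b x z" "b x (s c z) = c * b x z"
  by (rule b_unique, simp only: K_bilin, simp add: K_eq V.scale_left_distrib)+

lemma b_zero: "b 0 z = 0" "b x 0 = 0"
  using b_bilin(1)[of 0 0] b_bilin(2)[of x 0 0] by simp_all

lemma b_skew: "b z x = - b x z"
  by (rule b_unique) (metis K_swap K_eq V.scale_minus_left)

section \<open>Bijectivity of \<open>k\<close>\<close>

text \<open>\<open>K (k w) (k v)\<close> is \<open>b (k w) (k v)\<close> times \<open>k\<close>, and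
  the factor 2 in \<open>two_K_K'_K\<close> cancels in characteristic 0.\<close>

lemma k_K'_k: "k (K' w v (k u)) = - s (b (k w) (k v)) (k u)"
proof -
  have eq: "k (K' w v (k u)) + k (K' w v (k u)) = - (s (b (k w) (k v)) (k u) + s (b (k w) (k v)) (k u))"
    using two_K_K'_K[of x\<^sub>0 z\<^sub>0 w v u] by (simp add: k_eq[symmetric] K_eq)
  have two: "x + x = s 2 x" for x
    using V.scale_left_distrib[of 1 1 x] by simp
  have "s 2 (k (K' w v (k u))) = s 2 (- s (b (k w) (k v)) (k u))"
    using eq unfolding two by simp
  show ?thesis by (rule V.scale_left_imp_eq[OF _ \<open>s 2 _ = s 2 _\<close>]) simp
qed

text \<open>The range of \<open>k\<close> is the degree \<open>1\<close> part of the ideal that \<open>k\<close>, as an element of degree \<open>2\<close>,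
  generates in the 5-graded Lie algebra of the pair.\<close>

lemma surj_k: "surj k"
proof -
  define J where "J = range k"
  \<comment> \<open>An ideal with plus part \<open>J\<close> must contain these products; their span
    turns out to be large enough.\<close>
  define G where "G = {t' y i y' | y i y'. i \<in> J}"
  define I where "I = V'.span G"
  interpret f: kantor s' s t' t by (rule flip)
  have sJ: "V.subspace J"
    unfolding J_def V.subspace_def by (auto simp: image_iff) (metis k_0 k_linear)+
  have sI: "V'.subspace I" by (simp add: I_def)
  have kJ: "s c (k y) \<in> J" for c y
    unfolding J_def by (metis k_linear(3) rangeI)
  have J3: "t x y i \<in> J" if i: "i \<in> J" for x y i
  proof -
    obtain v where "i = k v" using i by (auto simp: J_def)
    then have "t x y i = s (b (k y) x) (k v) - k (t' y x v)"
      using k_D[of y x v] by (simp add: algebra_simps)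
    then show ?thesis using V.subspace_diff[OF sJ kJ] by (simp add: J_def)
  qed
  have J1: "t i y x \<in> J" if "i \<in> J" for x y i
    using t_swap[of i y x] J3[OF that] V.subspace_add[OF sJ _ kJ] by simp
  have gen: "t' y i y' \<in> I" if "i \<in> J" for y i y'
    unfolding I_def by (rule V'.span_base) (use that in \<open>auto simp: G_def\<close>)
  have J2: "t x y z \<in> J" if "y \<in> I" for x y z
    using that unfolding I_def
  proof (induction rule: V'.span_induct)
    case base
    have "0 \<in> J" "\<And>p q. p \<in> J \<Longrightarrow> q \<in> J \<Longrightarrow> p + q \<in> J" "\<And>c p. p \<in> J \<Longrightarrow> s c p \<in> J"
      using sJ by (auto simp: V.subspace_def)
    then show ?case by (intro V'.subspaceI) (auto simp: t_add t_zero t_scale)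
  next
    case (step g)
    then obtain y i w where g: "g = t' y i w" and i: "i \<in> J" by (auto simp: G_def)
    \<comment> \<open>\<open>KP1\<close> moves \<open>i\<close> out of the middle argument into
      outer slots, where \<open>J1\<close> and \<open>J3\<close> apply.\<close>
    have "t x g z = t (t i y x) w z + t x w (t i y z) - t i y (t x w z)"
      unfolding g using KP1[of i y x w z] by (simp add: algebra_simps)
    then show ?case using J1 J3 i sJ by (simp add: V.subspace_add V.subspace_diff)
  qed
  have I3: "t' x y z \<in> I" if "z \<in> I" for x y z
    using that unfolding I_def
  proof (induction rule: V'.span_induct)
    case base
    have "0 \<in> I" "\<And>p q. p \<in> I \<Longrightarrow> q \<in> I \<Longrightarrow> p + q \<in> I" "\<And>c p. p \<in> I \<Longrightarrow> s' c p \<in> I"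
      using sI by (auto simp: V'.subspace_def)
    then show ?case unfolding I_def by (intro V'.subspaceI) (auto simp: f.t_add f.t_zero f.t_scale)
  next
    case (step g)
    then obtain u i w where g: "g = t' u i w" and i: "i \<in> J" by (auto simp: G_def)
    have "t' x y g \<in> I"
      unfolding g f.KP1[of x y u i w] using gen J3 i sI by (simp add: V'.subspace_add V'.subspace_diff)
    then show ?case by (simp add: I_def)
  qed
  have I1: "t' x y z \<in> I" if "x \<in> I" for x y z
    using that unfolding I_def
  proof (induction rule: V'.span_induct)
    case base
    have "0 \<in> I" "\<And>p q. p \<in> I \<Longrightarrow> q \<in> I \<Longrightarrow> p + q \<in> I" "\<And>c p. p \<in> I \<Longrightarrow> s' c p \<in> I"
      using sI by (auto simp: V'.subspace_def)
    then show ?case unfolding I_def by (intro V'.subspaceI) (auto simp: f.t_add f.t_zero f.t_scale)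
  next
    case (step g)
    then obtain u i w where g: "g = t' u i w" and i: "i \<in> J" by (auto simp: G_def)
    \<comment> \<open>\<open>KP1\<close> is solved for the product with \<open>g\<close> in the
      first slot. The last term has an element of \<open>I\<close> in its last slot, which is why
      \<open>I3\<close> comes first.\<close>
    have "t' g y z = t' u i (t' w y z) + t' w (t i u y) z - t' w y (t' u i z)"
      unfolding g using f.KP1[of u i w y z] by (simp add: algebra_simps)
    moreover have "t' w y (t' u i z) \<in> I" by (rule I3) (rule gen[OF i])
    ultimately have "t' g y z \<in> I"
      using gen[OF i] gen[OF J1[OF i]] sI by (simp add: V'.subspace_add V'.subspace_diff)
    then show ?case by (simp add: I_def)
  qed
  have "(I = {0} \<and> J = {0}) \<or> (I = UNIV \<and> J = UNIV)"
    by (rule idealD[OF sI sJ I1 gen I3 J1 J2 J3])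
  moreover have "J \<noteq> {0}" using k_nonzero by (auto simp: J_def)
  ultimately show ?thesis by (auto simp: J_def)
qed

lemma k_K': "k (K' w v u) = - s (b (k w) (k v)) u"
  using k_K'_k surjD[OF surj_k] by metis

text \<open>Comparison of \<open>K_K'\<close> with \<open>k_K'\<close>. In the triple system
  \<open>X\<close> below it exchanges the first two arguments at the cost of a multiple of the
  third.\<close>

lemma t_k_swap: "t (k w) v u = t (k v) w u - s (b (k w) (k v)) u"
  using K_K'[of x\<^sub>0 z\<^sub>0 w v u] k_K'[of w v u] by (simp add: k_eq[symmetric] algebra_simps)

lemma inj_k: "inj k"
proof -
  interpret f: kantor s' s t' t by (rule flip)
  define N where "N = {w. k w = 0}"
  have "V'.subspace N"
    unfolding V'.subspace_def by (simp add: N_def k_0 k_linear)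
  have N3: "t' x y z \<in> N" if "z \<in> N" for x y z
    using that k_D[of x y z] by (simp add: N_def t_zero)
  have N1: "t' x y z \<in> N" if "x \<in> N" for x y z
    using N3[OF that, of z y] k_K'[of x z y] that
    by (simp add: N_def K_op_def k_linear b_zero)
  \<comment> \<open>With the first argument written as \<open>k w\<close>, \<open>t_k_swap\<close>
    brings \<open>y\<close> to the front as \<open>k y = 0\<close>.\<close>
  have N2: "t x y z = 0" if "y \<in> N" for x y z
    using t_k_swap[of _ y z] that surjD[OF surj_k, of x]
    by (auto simp: N_def t_zero b_zero)
  have "(N = {0} \<and> {0} = {0::'a}) \<or> (N = UNIV \<and> {0} = (UNIV :: 'a set))"
    by (rule idealD[OF \<open>V'.subspace N\<close> V.subspace_single_0 N1 _ N3])
      (auto simp: N2 t_zero f.t_zero V'.subspace_0[OF \<open>V'.subspace N\<close>])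
  then have "N = {0}"
    using k_nonzero by (auto simp: N_def)
  then have "w = 0" if "k w = 0" for w
    using that by (auto simp: N_def)
  then show ?thesis
    by (intro injI) (metis k_linear(2) right_minus_eq)
qed

text \<open>The corrections in \<open>k_D\<close> and \<open>t_k_swap\<close> are the same multiple
  of \<open>k v\<close> and cancel. The minus sign is that of the signed double.\<close>

lemma k_t': "k (t' w (k u) v) = - t (k w) u (k v)"
proof -
  have "k (t' w (k u) v) + t (k w) u (k v) = 0"
    using k_D[of w "k u" v] by (simp add: t_k_swap[of w u "k v"] algebra_simps)
  then show ?thesis by (simp add: eq_neg_iff_add_eq_0)
qed

text \<open>Compare the coefficients of \<open>k\<close> in \<open>K_derivation\<close>.\<close>

lemma b_D: "b (t u w x) z + b x (t u w z) = b x z * b (k w) u"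
  (is "?l = ?r")
proof -
  have "s ?l (k v) = s ?r (k v)" for v
    using K_derivation[of u w x z v] by (simp add: K_eq V.scale_left_distrib b_bilin)
  then show ?thesis using k_nonzero V.scale_right_imp_eq by blast
qed

text \<open>By \<open>b_D\<close> the radical \<open>R\<close> is stable in the last slot. For the
  other slots the corrections in \<open>t_swap\<close> and \<open>t_k_swap\<close> vanish on
  \<open>R\<close>, and \<open>k_t'\<close> transports stability to the preimage
  \<open>I\<close>.\<close>

lemma nondegenerate_b: "nondegenerate b"
proof -
  define R where "R = {x. \<forall>z. b x z = 0}"
  define I where "I = {w. k w \<in> R}"
  have sR: "V.subspace R"
    by (auto simp: V.subspace_def R_def b_bilin b_zero)
  have sI: "V'.subspace I"
    using sR by (auto simp: V'.subspace_def V.subspace_def I_def k_0 k_linear)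
  have R3: "t x y z \<in> R" if "z \<in> R" for x y z
    using that b_D[of x y z] by (simp add: R_def)
  have R1: "t x y z \<in> R" if "x \<in> R" for x y z
    using R3[OF that] that by (simp add: t_swap[of x y z] R_def)
  have R2: "t x y z \<in> R" if "y \<in> I" for x y z
  proof -
    obtain w where x: "x = k w" using surjD[OF surj_k] by blast
    have "b (k w) (k y) = 0" using that b_skew[of "k w" "k y"] by (simp add: I_def R_def)
    then show ?thesis using R1[of "k y" w z] that by (simp add: x t_k_swap[of w y z] I_def)
  qed
  have R_minus: "- x \<in> R" if "x \<in> R" for x
    using V.subspace_neg[OF sR that] .
  have I_t': "t' x y z \<in> I" if "x \<in> I \<or> y \<in> R \<or> z \<in> I" for x y z
  proof -
    obtain u where y: "y = k u" using surjD[OF surj_k] by blast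
    have "t (k x) u (k z) \<in> R" using that R1 R2 R3 by (auto simp: y I_def)
    then show ?thesis by (simp add: y I_def k_t' R_minus)
  qed
  have "(I = {0} \<and> R = {0}) \<or> (I = UNIV \<and> R = UNIV)"
    by (rule idealD[OF sI sR]) (use I_t' R1 R2 R3 in auto)
  \<comment> \<open>At \<open>x\<^sub>0\<close>, \<open>z\<^sub>0\<close> the equation
    \<open>K_eq\<close> says that \<open>k\<close> is \<open>b x\<^sub>0 z\<^sub>0\<close> times
    itself; hence \<open>R\<close> is not the whole space.\<close>
  moreover have "b x\<^sub>0 z\<^sub>0 \<noteq> 0"
    using k_nonzero K_eq[of x\<^sub>0 z\<^sub>0, folded k_eq] by force
  ultimately have "R = {0}" by (auto simp: R_def)
  then have "x = 0" if "\<forall>z. b x z = 0" for x using that by (auto simp: R_def)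
  then show ?thesis unfolding nondegenerate_def by (metis b_skew neg_equal_0_iff_equal)
qed

section \<open>The triple system on the plus space\<close>

text \<open>Passing the middle argument through \<open>inv k\<close> makes the operators
  \<open>K\<close> of \<open>X\<close> multiples of the identity.\<close>

definition X :: "('k, 'a) trip_system" where
  "X = \<lparr>scale_trip = s, prod_trip = (\<lambda>x y z. t x (inv k y) z)\<rparr>"

lemma k_inv [simp]: "k (inv k x) = x" and inv_k [simp]: "inv k (k y) = y"
  by (simp_all add: surj_k surj_f_inv_f inj_k)

lemma inv_k_linear: "inv k (x + y) = inv k x + inv k y" "inv k (s c x) = s' c (inv k x)"
  "inv k (- x) = - inv k x"
proof -
  have "k (inv k x + inv k y) = x + y" "k (s' c (inv k x)) = s c x" "k (- inv k x) = - x"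
    using k_linear(2)[of 0 "inv k x"] by (simp_all add: k_linear k_0)
  then show "inv k (x + y) = inv k x + inv k y" "inv k (s c x) = s' c (inv k x)"
    "inv k (- x) = - inv k x"
    by (metis inv_k)+
qed

lemma triple_system_X: "triple_system X"
  using vs by (simp add: triple_system_def X_def trilinear_def Vector_Spaces.linear_iff
      t_add t_scale inv_k_linear)

lemma inv_k_t: "inv k (- t x (inv k y) z) = t' (inv k x) y (inv k z)"
  using k_t'[of "inv k x" "inv k y" "inv k z"] by (metis inv_k k_inv)

lemma trilinear_pair_double: "trilinear_pair (signed_double X)"
proof -
  have "trilinear s s (\<lambda>x y z. - t x (inv k y) z)"
    using vs by (simp add: trilinear_def Vector_Spaces.linear_iff
      t_add t_scale inv_k_linear)
  then show ?thesis
    using vs triple_system_X by (simp add: trilinear_pair_def triple_system_def signed_double_def X_def)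
qed

text \<open>The identities are pulled back from the given pair along \<open>inv k\<close> and the
  identity map; \<open>inv_k_t\<close> accounts for the sign.\<close>

lemma Kantor_pair_double: "Kantor_pair (signed_double X)"
proof -
  let ?u = "\<lambda>x y z. t x (inv k y) z"
  have inj: "inj (inv k)"
    using surj_k by (rule surj_imp_inj_inv)
  have diff: "inv k (x - y) = inv k x - inv k y" for x y
    using inv_k_linear(1)[of x "- y"] inv_k_linear(3) by simp
  have "Kantor_identities (\<lambda>x y z. - ?u x y z) ?u"
    by (rule Kantor_identities_inj[OF Kantor', where g = "inv k" and f = "\<lambda>x. x"])
      (simp_all add: inj inv_k_t diff inv_k_linear(1))
  moreover have "Kantor_identities ?u (\<lambda>x y z. - ?u x y z)"
    by (rule Kantor_identities_inj[OF Kantor, where g = "\<lambda>x. x" and f = "inv k"])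
      (simp_all add: inv_k_t)
  ultimately show ?thesis
    using trilinear_pair_double by (simp add: Kantor_pair_def signed_double_def X_def)
qed

lemma skew_form_X: "skew_form_of X b"
proof -
  have "vector_space ((*) :: 'k \<Rightarrow> 'k \<Rightarrow> 'k)"
    by unfold_locales (simp_all add: algebra_simps)
  moreover have "t x (inv k z) y - t y (inv k z) x = s (b x y) z" for x y z
    using K_eq[of x y "inv k z"] by (simp add: K_op_def)
  ultimately show ?thesis
    using vs by (simp add: skew_form_of_def bilinear_form_def X_def Vector_Spaces.linear_iff b_bilin)
qed

lemma iso_X:
  "pair_iso \<lparr>scale_minus = s', scale_plus = s, prod_minus = t', prod_plus = t\<rparr>
     (signed_double X) k (\<lambda>x. x)"
proof -
  have "k (t' x y z) = - t (k x) (inv k y) (k z)" for x y z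
    using k_t'[of x "inv k y" z] by simp
  then show ?thesis
    using vs vs' by (simp add: pair_iso_def signed_double_def X_def Vector_Spaces.linear_iff
        k_linear bij_def inj_k surj_k)
qed

lemma nonzero_fd_balanced_FK_nondeg_X:
  assumes "fin_dim s"
  shows "nonzero_fd_balanced_FK_nondeg X"
proof -
  have "(UNIV :: 'a set) \<noteq> {0}"
    using k_nonzero by blast
  moreover have "fin_dim (scale_trip X)"
    using assms by (simp add: X_def)
  ultimately show ?thesis
    unfolding nonzero_fd_balanced_FK_nondeg_def FK_triple_system_1_1_def balanced_def
    using triple_system_X Kantor_pair_double skew_form_X nondegenerate_b by blast
qed

end

section \<open>One-dimensional spans of operators \<open>K\<close>\<close>

lemma vector_space_fun_scale:
  assumes "vector_space s"
  shows "vector_space (fun_scale s)"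
proof -
  interpret vector_space s by (rule assms)
  show ?thesis
    by unfold_locales (auto simp: fun_scale_def fun_eq_iff scale_right_distrib scale_left_distrib)
qed

lemma dim_K_space_eq_1:
  fixes t :: "'a \<Rightarrow> 'b \<Rightarrow> 'a \<Rightarrow> 'a::ab_group_add" and s :: "'k::field \<Rightarrow> 'a \<Rightarrow> 'a"
  assumes "vector_space s" and K: "\<And>x z. K_op t x z = fun_scale s (b x z) k"
    and "k \<noteq> 0" "b x\<^sub>0 z\<^sub>0 \<noteq> 0"
  shows "vector_space.dim (fun_scale s) (K_space s t) = 1"
proof -
  interpret F: vector_space "fun_scale s :: 'k \<Rightarrow> ('b \<Rightarrow> 'a) \<Rightarrow> _"
    using assms(1) by (rule vector_space_fun_scale)
  have "k = fun_scale s (inverse (b x\<^sub>0 z\<^sub>0)) (K_op t x\<^sub>0 z\<^sub>0)"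
    using assms(4) by (simp add: K)
  then have "k \<in> F.span {K_op t x z | x z. True}"
    by (metis (mono_tags, lifting) F.span_base F.span_scale mem_Collect_eq)
  then have "{k} \<subseteq> F.span {K_op t x z | x z. True}" by simp
  moreover have "{K_op t x z | x z. True} \<subseteq> F.span {k}"
    by (auto simp: K F.span_singleton)
  ultimately have "F.span {k} = K_space s t"
    unfolding K_space_def by (metis F.span_eq)
  moreover have "F.independent {k}"
    using assms(3) by simp
  ultimately show ?thesis
    using F.dim_span_eq_card_independent by fastforce
qed

text \<open>The basis is chosen inside the generating set, so \<open>k\<close> is itself a value of
  \<open>K_op t\<close> and inherits the identities for such operators.\<close>

lemma dim_K_space_eq_1_imp:
  fixes t :: "'a \<Rightarrow> 'b \<Rightarrow> 'a \<Rightarrow> 'a::ab_group_add" and s :: "'k::field \<Rightarrow> 'a \<Rightarrow> 'a"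
  assumes "vector_space s" and "vector_space.dim (fun_scale s) (K_space s t) = 1"
  obtains b k x\<^sub>0 z\<^sub>0 where "\<And>x z w. K_op t x z w = s (b x z) (k w)"
    and "k = K_op t x\<^sub>0 z\<^sub>0" and "\<exists>w. k w \<noteq> 0"
proof -
  interpret F: vector_space "fun_scale s :: 'k \<Rightarrow> ('b \<Rightarrow> 'a) \<Rightarrow> _"
    using assms(1) by (rule vector_space_fun_scale)
  define V where "V = {K_op t x z | x z. True}"
  obtain B where B: "B \<subseteq> V" "F.independent B" "V \<subseteq> F.span B" "card B = F.dim V"
    by (rule F.basis_exists)
  have "F.dim V = 1"
    using assms(2) by (simp add: V_def K_space_def)
  then obtain k where k: "B = {k}"
    using B(4) card_1_singletonE by metis
  then obtain x\<^sub>0 z\<^sub>0 where k_eq: "k = K_op t x\<^sub>0 z\<^sub>0"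
    using B(1) by (auto simp: V_def)
  have "\<exists>c. K_op t x z = fun_scale s c k" for x z
    using B(3) unfolding k F.span_singleton V_def by blast
  then obtain b where b: "K_op t x z = fun_scale s (b x z) k" for x z
    by metis
  have "k \<noteq> 0"
    using B(2) by (simp add: k)
  show thesis
  proof
    show "K_op t x z w = s (b x z) (k w)" for x z w
      using fun_cong[OF b[of x z], of w] by (simp add: fun_scale_def)
    show "k = K_op t x\<^sub>0 z\<^sub>0" by (rule k_eq)
    show "\<exists>w. k w \<noteq> 0"
      using \<open>k \<noteq> 0\<close> by (auto simp: fun_eq_iff)
  qed
qed

section \<open>Finite dimension and simplicity for the converse direction\<close>

lemma fin_dim_linear_bij:
  assumes "Vector_Spaces.linear s r f" "bij f" "fin_dim r"
  shows "fin_dim s"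
proof -
  obtain B where "finite_dimensional_vector_space r B"
    using assms(3) by (auto simp: fin_dim_def)
  interpret R: finite_dimensional_vector_space r B by fact
  have g: "Vector_Spaces.linear r s (inv f)"
    using assms(1) unfolding Vector_Spaces.linear_iff
    by (metis assms(2) bij_inv_eq_iff)
  interpret G: Vector_Spaces.linear r s "inv f" by (rule g)
  have bij: "bij (inv f)"
    using assms(2) by (rule bij_imp_bij_inv)
  have "finite_dimensional_vector_space s (inv f ` B)"
  proof unfold_locales
    show "finite (inv f ` B)"
      using R.finite_Basis by simp
    show "\<not> G.vs2.dependent (inv f ` B)"
      by (rule G.independent_injective_image[OF R.independent_Basis])
        (meson bij bij_is_inj inj_on_subset subset_UNIV)
    show "G.vs2.span (inv f ` B) = UNIV"
      using bij by (simp add: G.span_image R.span_Basis bij_is_surj)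
  qed
  then show ?thesis by (auto simp: fin_dim_def)
qed

text \<open>If \<open>x\<close> in \<open>J\<close> is nonzero, pick \<open>z\<close> with
  \<open>b x z\<close> nonzero: then \<open>J\<close> contains \<open>k w\<close> for all
  \<open>w\<close>, hence everything. Letting instead the middle argument of \<open>K_op\<close>
  range over a full component fills the opposite one.\<close>

lemma simple_pair_if_nondegenerate:
  fixes P :: "('k::field, 'm::ab_group_add, 'p::ab_group_add) trilin_pair" and x\<^sub>0 :: 'p
  assumes "trilinear_pair P"
    and K: "\<And>x z w. K_op (prod_plus P) x z w = scale_plus P (b x z) (k w)"
    and K': "\<And>x z w. K_op (prod_minus P) x z w = scale_minus P (b' x z) (k' w)"
    and "surj k" "surj k'"
    and b: "\<And>x. x \<noteq> 0 \<Longrightarrow> \<exists>z. b x z \<noteq> 0" and b': "\<And>x. x \<noteq> 0 \<Longrightarrow> \<exists>z. b' x z \<noteq> 0"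
    and nz: "x\<^sub>0 \<noteq> 0"
  shows "simple_pair P"
  unfolding simple_pair_def
proof (intro conjI allI impI)
  interpret V: vector_space "scale_plus P" using assms(1) by (simp add: trilinear_pair_def)
  interpret V': vector_space "scale_minus P" using assms(1) by (simp add: trilinear_pair_def)
  obtain z\<^sub>0 where "b x\<^sub>0 z\<^sub>0 \<noteq> 0" using b nz by blast
  moreover obtain w where "k w = x\<^sub>0" using \<open>surj k\<close> by (metis surjD)
  ultimately have "K_op (prod_plus P) x\<^sub>0 z\<^sub>0 w \<noteq> 0" by (simp add: K nz)
  then have "prod_plus P x\<^sub>0 w z\<^sub>0 \<noteq> 0 \<or> prod_plus P z\<^sub>0 w x\<^sub>0 \<noteq> 0" by (auto simp: K_op_def)
  then show "(\<exists>x y z. prod_minus P x y z \<noteq> 0) \<or> (\<exists>x y z. prod_plus P x y z \<noteq> 0)" by blast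
  fix I J
  assume ideal: "pair_ideal P I J"
  then have sI: "V'.subspace I" and sJ: "V.subspace J"
    by (simp_all add: pair_ideal_def)
  have zero_in: "0 \<in> I" "0 \<in> J"
    using sI sJ by (simp_all add: V.subspace_0 V'.subspace_0)
  have kJ: "k w \<in> J" if "K_op (prod_plus P) x z w \<in> J" "b x z \<noteq> 0" for x z w
    using that V.subspace_scale[OF sJ, of "K_op (prod_plus P) x z w" "inverse (b x z)"] by (simp add: K)
  have kI: "k' w \<in> I" if "K_op (prod_minus P) x z w \<in> I" "b' x z \<noteq> 0" for x z w
    using that V'.subspace_scale[OF sI, of "K_op (prod_minus P) x z w" "inverse (b' x z)"] by (simp add: K')
  have KJ: "K_op (prod_plus P) x z w \<in> J" if "x \<in> J \<or> w \<in> I" for x z w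
    using ideal that V.subspace_diff[OF sJ] by (auto simp: pair_ideal_def K_op_def)
  have KI: "K_op (prod_minus P) x z w \<in> I" if "x \<in> I \<or> w \<in> J" for x z w
    using ideal that V'.subspace_diff[OF sI] by (auto simp: pair_ideal_def K_op_def)
  have J_UNIV: "J = UNIV" if "x \<in> J" "x \<noteq> 0" for x
    using b[OF that(2)] KJ kJ that(1) \<open>surj k\<close> by (metis UNIV_eq_I surjD)
  have I_UNIV: "I = UNIV" if "x \<in> I" "x \<noteq> 0" for x
    using b'[OF that(2)] KI kI that(1) \<open>surj k'\<close> by (metis UNIV_eq_I surjD)
  have "I = UNIV" if "J = UNIV"
  \<comment> \<open>If the minus space is zero, \<open>I\<close> is all of it because it contains 0;
    otherwise \<open>b'\<close> takes a nonzero value.\<close>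
  proof (cases "\<exists>y::'m. y \<noteq> 0")
    case True
    then obtain y z where "b' y z \<noteq> 0" using b' by blast
    then show ?thesis using KI kI that \<open>surj k'\<close> by (metis UNIV_I UNIV_eq_I surjD)
  next
    case False
    then show ?thesis using zero_in by (metis UNIV_eq_I)
  qed
  moreover have "J = UNIV" if "I = UNIV"
    using KJ kJ that \<open>surj k\<close> \<open>b x\<^sub>0 z\<^sub>0 \<noteq> 0\<close> by (metis UNIV_I UNIV_eq_I surjD)
  ultimately show "(I = {0} \<and> J = {0}) \<or> (I = UNIV \<and> J = UNIV)"
    using I_UNIV J_UNIV zero_in by blast
qed

section \<open>The two directions of the equivalence\<close>

lemma close_to_Jordan_imp_double:
  fixes P :: "('k::field_char_0, 'm::ab_group_add, 'p::ab_group_add) trilin_pair"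
  assumes "fin_dim_pair P" "simple_pair P" "close_to_Jordan_pair P"
  obtains X :: "('k, 'p) trip_system"
  where "nonzero_fd_balanced_FK_nondeg X" "isomorphic_pairs P (signed_double X)"
proof -
  have Kp: "Kantor_pair P"
    and dim: "vector_space.dim (fun_scale (scale_plus P)) (K_space (scale_plus P) (prod_plus P)) = 1"
    using assms(3) by (simp_all add: close_to_Jordan_pair_def)
  then have tri: "trilinear_pair P" by (simp add: Kantor_pair_def)
  then have vs: "vector_space (scale_plus P)" by (simp add: trilinear_pair_def)
  have kantor: "kantor (scale_plus P) (scale_minus P) (prod_plus P) (prod_minus P)"
    using tri Kp by (simp add: kantor_def trilinear_pair_def Kantor_pair_def)
  have simple: "simple_pair \<lparr>scale_minus = scale_minus P, scale_plus = scale_plus P,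
      prod_minus = prod_minus P, prod_plus = prod_plus P\<rparr>"
    using assms(2) by (cases P) simp
  obtain b k x\<^sub>0 z\<^sub>0 where k:
    "\<And>x z w. K_op (prod_plus P) x z w = scale_plus P (b x z) (k w)"
    "k = K_op (prod_plus P) x\<^sub>0 z\<^sub>0" "\<exists>w. k w \<noteq> 0"
    by (rule dim_K_space_eq_1_imp[OF vs dim]) (rule that)
  interpret simple_kantor "scale_plus P" "scale_minus P" "prod_plus P" "prod_minus P" b k x\<^sub>0 z\<^sub>0
    by (intro simple_kantor.intro simple_kantor_axioms.intro) (rule kantor simple k)+
  show thesis
  proof
    show "nonzero_fd_balanced_FK_nondeg X"
      using nonzero_fd_balanced_FK_nondeg_X assms(1) by (simp add: fin_dim_pair_def)
    show "isomorphic_pairs P (signed_double X)"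
      unfolding isomorphic_pairs_def by (cases P) (use iso_X in auto)
  qed
qed

text \<open>In the signed double the operators \<open>K\<close> are the skew form times the
  identity, up to the sign of the component. Transport along the isomorphism gives a non-degenerate
  form times a bijection on each side of \<open>P\<close>.\<close>

lemma double_imp_close_to_Jordan:
  assumes tri: "trilinear_pair P" and X: "nonzero_fd_balanced_FK_nondeg X"
    and "isomorphic_pairs P (signed_double X)"
  shows "fin_dim_pair P" "simple_pair P" "close_to_Jordan_pair P"
proof -
  obtain f g where iso: "pair_iso P (signed_double X) f g"
    using assms(3) by (auto simp: isomorphic_pairs_def)
  define r where "r = scale_trip X"
  define u where "u = prod_trip X"
  interpret V: vector_space "scale_plus P" using tri by (simp add: trilinear_pair_def)
  interpret V': vector_space "scale_minus P" using tri by (simp add: trilinear_pair_def)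
  have f: "Vector_Spaces.linear (scale_minus P) r f" "bij f"
    and f_prod: "\<And>x y z. f (prod_minus P x y z) = - u (f x) (g y) (f z)"
    and g: "Vector_Spaces.linear (scale_plus P) r g" "bij g"
    and g_prod: "\<And>x y z. g (prod_plus P x y z) = u (g x) (f y) (g z)"
    using iso by (simp_all add: pair_iso_def signed_double_def r_def u_def)
  interpret F: Vector_Spaces.linear "scale_minus P" r f by (rule f)
  interpret G: Vector_Spaces.linear "scale_plus P" r g by (rule g)
  have fd: "fin_dim r" and "Kantor_pair (signed_double X)"
    using X by (simp_all add: nonzero_fd_balanced_FK_nondeg_def FK_triple_system_1_1_def r_def)
  then have Kantor: "Kantor_identities u (\<lambda>x y z. - u x y z)"
    "Kantor_identities (\<lambda>x y z. - u x y z) u"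
    by (simp_all add: Kantor_pair_def signed_double_def u_def)
  obtain B where B: "skew_form_of X B" "nondegenerate B"
    using X by (auto simp: nonzero_fd_balanced_FK_nondeg_def)
  have u: "u x z y - u y z x = r (B x y) z" for x y z
    using B(1) by (simp add: skew_form_of_def r_def u_def)
  obtain x\<^sub>1 :: 'd where "x\<^sub>1 \<noteq> 0"
    using X by (auto simp: nonzero_fd_balanced_FK_nondeg_def)
  show "fin_dim_pair P"
    unfolding fin_dim_pair_def using fin_dim_linear_bij[OF f fd] fin_dim_linear_bij[OF g fd] ..
  have inv: "g (inv g x) = x" "f (inv f x) = x" for x
    using f(2) g(2) by (simp_all add: bij_is_surj surj_f_inv_f)
  \<comment> \<open>An operator \<open>K\<close> sends one component of \<open>P\<close> to the
    other, so the identity of \<open>X\<close> becomes \<open>inv g\<close> after \<open>f\<close>,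
    or \<open>inv f\<close> after \<open>g\<close>. The sign in \<open>?b'\<close> is that of the
    minus product.\<close>
  let ?b = "\<lambda>x z. B (g x) (g z)" and ?k = "inv g \<circ> f"
  let ?b' = "\<lambda>x z. - B (f x) (f z)" and ?k' = "inv f \<circ> g"
  have K: "K_op (prod_plus P) x z w = scale_plus P (?b x z) (?k w)" for x z w
  proof -
    have "g (K_op (prod_plus P) x z w) = g (scale_plus P (?b x z) (?k w))"
      by (simp add: K_op_def G.diff G.scale g_prod u inv)
    then show ?thesis using g(2) by (simp add: bij_def inj_eq)
  qed
  have K': "K_op (prod_minus P) x z w = scale_minus P (?b' x z) (?k' w)" for x z w
  proof -
    have "f (K_op (prod_minus P) x z w) = f (scale_minus P (?b' x z) (?k' w))"
      using u[of "f x" "g w" "f z"]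
      by (simp add: K_op_def F.diff F.neg F.scale f_prod inv algebra_simps)
    then show ?thesis using f(2) by (simp add: bij_def inj_eq)
  qed
  have "surj ?k" "surj ?k'"
    using f(2) g(2) by (intro bij_is_surj bij_comp bij_imp_bij_inv; simp)+
  have b: "\<exists>z. ?b x z \<noteq> 0" if "x \<noteq> 0" for x
  proof -
    have "g x \<noteq> 0" using that g(2) G.zero by (metis bij_def inj_eq)
    then show ?thesis using B(2) unfolding nondegenerate_def by (metis inv(1))
  qed
  have b': "\<exists>z. ?b' x z \<noteq> 0" if "x \<noteq> 0" for x
  proof -
    have "f x \<noteq> 0" using that f(2) F.zero by (metis bij_def inj_eq)
    then show ?thesis using B(2) unfolding nondegenerate_def by (metis inv(2) neg_equal_0_iff_equal)
  qed
  have nz: "inv g x\<^sub>1 \<noteq> 0" "inv f x\<^sub>1 \<noteq> 0"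
    using \<open>x\<^sub>1 \<noteq> 0\<close> inv F.zero G.zero by metis+
  show "simple_pair P"
    by (rule simple_pair_if_nondegenerate[where b = ?b and k = ?k and b' = ?b' and k' = ?k',
          OF tri K K' \<open>surj ?k\<close> \<open>surj ?k'\<close> b b' nz(1)])
  have "Kantor_pair P"
    unfolding Kantor_pair_def
  proof (intro conjI tri)
    show "Kantor_identities (prod_minus P) (prod_plus P)"
      by (rule Kantor_identities_inj[OF Kantor(2), where g = f and f = g])
        (use f(2) in \<open>simp_all add: bij_def F.diff F.add f_prod g_prod\<close>)
    show "Kantor_identities (prod_plus P) (prod_minus P)"
      by (rule Kantor_identities_inj[OF Kantor(1), where g = g and f = f])
        (use g(2) in \<open>simp_all add: bij_def G.diff G.add f_prod g_prod\<close>)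
  qed
  moreover have "vector_space.dim (fun_scale (scale_plus P)) (K_space (scale_plus P) (prod_plus P)) = 1"
  proof -
    obtain z where z: "?b (inv g x\<^sub>1) z \<noteq> 0" using b[OF nz(1)] by blast
    have "?k \<noteq> 0" using surjD[OF \<open>surj ?k\<close>] nz(1) by (metis zero_fun_apply)
    show ?thesis
      by (rule dim_K_space_eq_1[OF V.vector_space_axioms, where b = ?b, OF _ \<open>?k \<noteq> 0\<close> z])
        (simp add: fun_eq_iff fun_scale_def K)
  qed
  moreover have "vector_space.dim (fun_scale (scale_minus P)) (K_space (scale_minus P) (prod_minus P)) = 1"
  proof -
    obtain z where z: "?b' (inv f x\<^sub>1) z \<noteq> 0" using b'[OF nz(2)] by blast
    have "?k' \<noteq> 0" using surjD[OF \<open>surj ?k'\<close>] nz(2) by (metis zero_fun_apply)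
    show ?thesis
      by (rule dim_K_space_eq_1[OF V'.vector_space_axioms, where b = ?b', OF _ \<open>?k' \<noteq> 0\<close> z])
        (simp add: fun_eq_iff fun_scale_def K')
  qed
  ultimately show "close_to_Jordan_pair P"
    by (simp add: close_to_Jordan_pair_def)
qed

text \<open>The constructed triple system lives on the plus space, which fixes the type in the
  existential; the second conjunct gives the converse for triple systems on any type.\<close>

theorem theorem5p5p2:
  fixes P :: "('k::{alg_closed_field, field_char_0}, 'm::ab_group_add, 'p::ab_group_add) trilin_pair"
  assumes "trilinear_pair P"
  shows
    "(fin_dim_pair P \<and> simple_pair P \<and> close_to_Jordan_pair P \<longleftrightarrow>
       (\<exists>X :: ('k, 'p) trip_system.
          nonzero_fd_balanced_FK_nondeg X \<and> isomorphic_pairs P (signed_double X))) \<and>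
     (\<forall>X :: ('k, 'x::ab_group_add) trip_system.
          nonzero_fd_balanced_FK_nondeg X \<and> isomorphic_pairs P (signed_double X) \<longrightarrow>
          fin_dim_pair P \<and> simple_pair P \<and> close_to_Jordan_pair P)"
proof (intro conjI allI impI iffI)
  assume "fin_dim_pair P \<and> simple_pair P \<and> close_to_Jordan_pair P"
  then show "\<exists>X :: ('k, 'p) trip_system.
      nonzero_fd_balanced_FK_nondeg X \<and> isomorphic_pairs P (signed_double X)"
    by (metis close_to_Jordan_imp_double)
qed (auto intro: double_imp_close_to_Jordan[OF assms])

end
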